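(* Let $d\in\mathbb{N}$ and let $E\subset\mathbb{C}^d$ and $F\subset\mathbb{C}^d$ be compact sets. (i) If $E\subset F$, then $t_{\mathbb{Z}}(n,E)\le t_{\mathbb{Z}}(n,F)$ for all $n\in\mathbb{N}_0$, and $t_{\mathbb{Z}}(E)\le t_{\mathbb{Z}}(F)$. (ii) For $\delta>0$ define $E_\delta:=\bigcup_{w\in E}\{z\in\mathbb{C}^d:|z-w|\le\delta\}$, where $|z-w|$ is the Euclidean distance in $\mathbb{C}^d$ (identified with $\mathbb{R}^{2d}$). For any $\varepsilon>0$ there exists $\delta>0$ such that \[ 0\le t_{\mathbb{Z}}(E_\delta)-t_{\mathbb{Z}}(E)\le\varepsilon. \]
   Context: $\mathbb{N}_0=\mathbb{N}\cup\{0\}$. $\mathcal{P}_n^d(\mathbb{Z})$ is the set of polynomials $\sum_{|k|\le n}a_kz^k$ in $d$ complex variables of (total) degree at most $n$ with integer coefficients, where $k\in\mathbb{N}_0^d$, $|k|=\sum_i k_i$, $z^k=z_1^{k_1}\cdots z_d^{k_d}$. For compact $E\subset\mathbb{C}^d$, $\|f\|_E:=\sup_{z\in E}|f(z)|$. Define $t_{\mathbb{Z}}(n,E):=\inf\{\|P\|_E: P\in\mathcal{P}_n^d(\mathbb{Z}),\ P\not\equiv 0\}$ and the multivariate integer Chebyshev constant $t_{\mathbb{Z}}(E):=\lim_{n\to\infty}t_{\mathbb{Z}}(n,E)^{1/n}$. *)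

theory Defs
  imports "HOL-Analysis.Analysis"
begin

text \<open>
  The number of variables \<open>d\<close> is \<open>CARD('d)\<close>, for an arbitrary finite index type \<open>'d\<close>;
  multi-indices are functions \<open>k :: 'd \<Rightarrow> nat\<close>.
\<close>

definition monomial :: "('d::finite \<Rightarrow> nat) \<Rightarrow> complex ^ 'd \<Rightarrow> complex" where
  "monomial k z = (\<Prod>i\<in>UNIV. (z $ i) ^ k i)"

text \<open>The sum in the next definition ranges over a finite set, hence is a genuine sum.\<close>

lemma finite_multi_indices: "finite {k :: 'd::finite \<Rightarrow> nat. sum k UNIV \<le> n}"
proof (rule finite_subset)
  have "k i \<le> n" if "sum k UNIV \<le> n" for k :: "'d \<Rightarrow> nat" and i
    using member_le_sum[of i UNIV k] that by simp
  then show "{k :: 'd \<Rightarrow> nat. sum k UNIV \<le> n} \<subseteq> (UNIV :: 'd set) \<rightarrow>\<^sub>E {..n}"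
    by (simp add: subset_iff PiE_UNIV_domain)
  show "finite ((UNIV :: 'd set) \<rightarrow>\<^sub>E {..n})"
    by (simp add: finite_PiE)
qed

text \<open>
  Polynomials are taken as functions on \<open>\<complex>\<^sup>d\<close>. As \<open>\<complex>\<close> is infinite, such a function
  is identically zero only if all its coefficients are zero.
\<close>

definition int_polys :: "nat \<Rightarrow> (complex ^ 'd::finite \<Rightarrow> complex) set" where
  "int_polys n = {P. \<exists>a :: ('d \<Rightarrow> nat) \<Rightarrow> int.
     P = (\<lambda>z. \<Sum>k | sum k UNIV \<le> n. of_int (a k) * monomial k z)}"

text \<open>
  The supremum over the empty set is taken in \<open>[0,\<infinity>)\<close>, i.e. it is 0 (on the type
  \<^typ>\<open>real\<close>, \<open>Sup {}\<close> is unspecified).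
\<close>

definition sup_norm :: "'a set \<Rightarrow> ('a \<Rightarrow> complex) \<Rightarrow> real" where
  "sup_norm E f = (if E = {} then 0 else (SUP z\<in>E. norm (f z)))"

definition t_int_n :: "nat \<Rightarrow> (complex ^ 'd::finite) set \<Rightarrow> real" where
  "t_int_n n E = (INF P\<in>{P \<in> int_polys n. P \<noteq> (\<lambda>z. 0)}. sup_norm E P)"

text \<open>
  For compact \<open>E\<close> the limit exists, because
  \<open>t_int_n (m + n) E \<le> t_int_n m E * t_int_n n E\<close>. The term at \<open>n = 0\<close>, where
  \<open>root 0 x = 0\<close>, is irrelevant.
\<close>

definition t_int :: "(complex ^ 'd::finite) set \<Rightarrow> real" where
  "t_int E = lim (\<lambda>n. root n (t_int_n n E))"

text \<open>The norm on \<^typ>\<open>complex ^ 'd\<close> is the Euclidean norm of \<open>\<complex>\<^sup>d = \<real>\<^sup>2\<^sup>d\<close>.\<close>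

definition fattening :: "real \<Rightarrow> (complex ^ 'd::finite) set \<Rightarrow> (complex ^ 'd) set" where
  "fattening \<delta> E = (\<Union>w\<in>E. {z. norm (z - w) \<le> \<delta>})"

end

theory Submission
  imports Defs "HOL-Computational_Algebra.Polynomial"
begin

text \<open>
  Part (i) only needs that enlarging the set enlarges the supremum norm, once the limit
  defining \<open>t_int\<close> is known to exist. For this, the product of two nonzero integer polynomials
  is a nonzero integer polynomial (\<open>int_polys_mult\<close>, \<open>int_polys_mult_nonzero\<close>) and the supremum
  norm is submultiplicative, so \<open>t_int_n\<close> is a submultiplicative sequence. Fekete's lemma
  (\<open>fekete_root\<close>) then says more than convergence: the limit is the infimum of the \<open>n\<close>-th roots.

  Part (ii) rests on this infimum. If \<open>c\<close> is larger than \<open>t_int E\<close>, then a single nonzero integer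
  polynomial \<open>P\<close> of degree at most some \<open>n \<ge> 1\<close> satisfies \<open>\<bar>P\<bar> < c\<^sup>n\<close> on \<open>E\<close>. By continuity and
  compactness the inequality persists on a fattening of \<open>E\<close>, and since the limit is an infimum, this
  one polynomial bounds the constant of the fattening by \<open>c\<close>.
\<close>

section \<open>Fekete's lemma\<close>

lemma submultiplicative_power_mult_le:
  fixes a :: "nat \<Rightarrow> real"
  assumes nonneg: "\<And>n. 0 \<le> a n" and submult: "\<And>m n. a (m + n) \<le> a m * a n"
  shows "a (q * m + r) \<le> a m ^ q * a r"
proof (induction q)
  case (Suc q)
  have "a (Suc q * m + r) = a (m + (q * m + r))"
    by (simp add: add.assoc)
  also have "\<dots> \<le> a m * a (q * m + r)"
    by (rule submult)
  also have "\<dots> \<le> a m * (a m ^ q * a r)"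
    by (intro mult_left_mono Suc nonneg)
  finally show ?case
    by (simp add: mult.assoc)
qed simp

text \<open>
  Division with remainder, \<open>n = q m + r\<close>, shows that one good term \<open>a m < c\<^sup>m\<close> forces
  \<open>a n \<le> B c\<^sup>n\<close> for all \<open>n\<close>, where \<open>B\<close> absorbs the finitely many remainders; and the \<open>n\<close>-th root of
  \<open>B\<close> tends to 1. Working with roots instead of logarithms allows terms that are zero.
\<close>

lemma fekete_root:
  fixes a :: "nat \<Rightarrow> real"
  assumes nonneg: "\<And>n. 0 \<le> a n" and submult: "\<And>m n. a (m + n) \<le> a m * a n"
  shows "(\<lambda>n. root n (a n)) \<longlonglongrightarrow> (INF n\<in>{1..}. root n (a n))"
proof (rule order_tendstoI)
  let ?L = "INF n\<in>{1..}. root n (a n)"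
  have bdd: "bdd_below ((\<lambda>n. root n (a n)) ` {1..})"
    by (rule bdd_belowI2[where m = 0]) (simp add: nonneg)
  have lower: "?L \<le> root n (a n)" if "n \<ge> 1" for n
    using that by (intro cINF_lower bdd) simp
  show "\<forall>\<^sub>F n in sequentially. y < root n (a n)" if "y < ?L" for y
    using eventually_ge_at_top[of 1] by eventually_elim (use lower that in fastforce)
  show "\<forall>\<^sub>F n in sequentially. root n (a n) < y" if "?L < y" for y
  proof -
    obtain m where m: "m \<ge> 1" "root m (a m) < y"
      using \<open>?L < y\<close> cINF_less_iff[OF _ bdd, of y] by auto
    obtain c where c: "root m (a m) < c" "c < y"
      using dense m(2) by blast
    have root_nonneg: "0 \<le> root m (a m)"
      using m(1) nonneg by simp
    then have c_pos: "0 < c"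
      using c(1) by linarith
    have "a m = root m (a m) ^ m"
      using m(1) nonneg by simp
    also have "\<dots> \<le> c ^ m"
      using c(1) root_nonneg by (intro power_mono) simp_all
    finally have am: "a m \<le> c ^ m" .
    define B where "B = 1 + (\<Sum>r<m. a r / c ^ r)"
    have B_pos: "0 < B"
      unfolding B_def using nonneg c_pos by (intro add_pos_nonneg sum_nonneg) simp_all
    have bound: "a n \<le> B * c ^ n" for n
    proof -
      define r where "r = n mod m"
      define q where "q = n div m"
      have n: "n = q * m + r" and r: "r < m"
        using m(1) by (simp_all add: r_def q_def)
      have "a r / c ^ r \<le> (\<Sum>r<m. a r / c ^ r)"
        using r nonneg c_pos by (intro member_le_sum) simp_all
      then have "a r / c ^ r \<le> B"
        by (simp add: B_def)
      then have ar: "a r \<le> B * c ^ r"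
        using c_pos by (simp add: divide_le_eq)
      have "a n \<le> a m ^ q * a r"
        unfolding n by (rule submultiplicative_power_mult_le[OF nonneg submult])
      also have "\<dots> \<le> (c ^ m) ^ q * (B * c ^ r)"
        using am ar nonneg c_pos by (intro mult_mono power_mono) simp_all
      also have "\<dots> = B * c ^ n"
        by (simp add: n power_add power_mult mult.commute)
      finally show ?thesis .
    qed
    have "(\<lambda>n. root n B * c) \<longlonglongrightarrow> 1 * c"
      by (intro tendsto_mult LIMSEQ_root_const B_pos tendsto_const)
    then have "\<forall>\<^sub>F n in sequentially. root n B * c < y"
      using c(2) by (intro order_tendstoD(2)) simp_all
    with eventually_ge_at_top[of 1] show ?thesis
    proof eventually_elim
      case (elim n)
      have "root n (a n) \<le> root n (B * c ^ n)"
        using elim(1) by (intro real_root_le_mono bound) simp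
      also have "\<dots> = root n B * c"
        using elim(1) c_pos by (simp add: real_root_mult real_root_power_cancel)
      finally show ?case
        using elim(2) by linarith
    qed
  qed
qed

section \<open>Products of integer polynomials\<close>

lemma monomial_add: "monomial (\<lambda>i. k i + l i) z = monomial k z * monomial l z"
  by (simp add: monomial_def power_add prod.distrib)

lemma int_polys_mult:
  fixes P Q :: "complex ^ 'd::finite \<Rightarrow> complex"
  assumes "P \<in> int_polys m" and "Q \<in> int_polys n"
  shows "(\<lambda>z. P z * Q z) \<in> int_polys (m + n)"
proof -
  let ?K = "\<lambda>n. {k :: 'd \<Rightarrow> nat. sum k UNIV \<le> n}"
  let ?S = "?K m \<times> ?K n"
  let ?g = "\<lambda>(k, l). (\<lambda>i. k i + l i) :: 'd \<Rightarrow> nat"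
  obtain a b where P: "P = (\<lambda>z. \<Sum>k\<in>?K m. of_int (a k) * monomial k z)"
    and Q: "Q = (\<lambda>z. \<Sum>l\<in>?K n. of_int (b l) * monomial l z)"
    using assms by (auto simp: int_polys_def)
  \<comment> \<open>the coefficients of the product: the convolution of those of the factors\<close>
  define c where "c j = (\<Sum>(k, l)\<in>{x \<in> ?S. ?g x = j}. a k * b l)" for j
  have fin: "finite ?S"
    by (intro finite_cartesian_product finite_multi_indices)
  have img: "?g ` ?S \<subseteq> ?K (m + n)"
    by (auto simp: sum.distrib intro: add_mono)
  have "P z * Q z = (\<Sum>j\<in>?K (m + n). of_int (c j) * monomial j z)" for z
  proof -
    have "P z * Q z = (\<Sum>(k, l)\<in>?S. (of_int (a k) * monomial k z) * (of_int (b l) * monomial l z))"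
      by (simp add: P Q sum_product sum.cartesian_product)
    also have "\<dots> = (\<Sum>x\<in>?S. of_int (a (fst x) * b (snd x)) * monomial (?g x) z)"
      by (intro sum.cong) (auto simp: monomial_add)
    also have "\<dots> = (\<Sum>j\<in>?K (m + n). \<Sum>x\<in>{x \<in> ?S. ?g x = j}.
        of_int (a (fst x) * b (snd x)) * monomial (?g x) z)"
      by (intro sum.group[symmetric] fin img finite_multi_indices)
    also have "\<dots> = (\<Sum>j\<in>?K (m + n). of_int (c j) * monomial j z)"
      by (intro sum.cong refl) (simp add: c_def sum_distrib_right split_beta)
    finally show ?thesis .
  qed
  then show ?thesis
    by (auto simp: int_polys_def)
qed

lemma one_in_int_polys: "(\<lambda>z. 1) \<in> int_polys n"
proof -
  have "1 = (\<Sum>k | sum k UNIV \<le> n. of_int (if k = (\<lambda>_. 0) then 1 else 0) * monomial k z)"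
    for z :: "complex ^ 'd::finite"
  proof -
    have "(\<Sum>k | sum k UNIV \<le> n. of_int (if k = (\<lambda>_. 0) then 1 else 0) * monomial k z)
        = (\<Sum>k | sum k UNIV \<le> n. if k = (\<lambda>_. 0) then monomial k z else 0)"
      by (intro sum.cong) auto
    also have "\<dots> = 1"
      by (simp add: sum.delta finite_multi_indices monomial_def)
    finally show ?thesis
      by simp
  qed
  then show ?thesis
    unfolding int_polys_def
    by (intro CollectI exI[of _ "\<lambda>k. if k = (\<lambda>_. 0) then 1 else 0"] ext)
qed

lemma continuous_on_int_poly:
  assumes "P \<in> int_polys n"
  shows "continuous_on S P"
  using assms by (auto simp: int_polys_def monomial_def intro!: continuous_intros)

lemma int_poly_on_line:
  fixes P :: "complex ^ 'd::finite \<Rightarrow> complex"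
  assumes "P \<in> int_polys n"
  obtains p :: "complex poly" where "\<And>t. poly p t = P (\<chi> i. u $ i + t * v $ i)"
proof -
  obtain a where P: "P = (\<lambda>z. \<Sum>k | sum k UNIV \<le> n. of_int (a k) * monomial k z)"
    using assms by (auto simp: int_polys_def)
  show thesis
    by (rule that[of "\<Sum>k | sum k UNIV \<le> n. smult (of_int (a k)) (\<Prod>i\<in>UNIV. [:u $ i, v $ i:] ^ k i)"])
      (simp add: P monomial_def poly_sum poly_prod)
qed

text \<open>
  Take \<open>u\<close> with \<open>P u \<noteq> 0\<close> and \<open>w\<close> with \<open>Q w \<noteq> 0\<close>. Along \<open>t \<mapsto> u + t (w - u)\<close> both
  functions are nonzero polynomials in \<open>t\<close>, and there are no zero divisors in one variable.
\<close>

lemma int_polys_mult_nonzero: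
  fixes P Q :: "complex ^ 'd::finite \<Rightarrow> complex"
  assumes "P \<in> int_polys m" "Q \<in> int_polys n" "P \<noteq> (\<lambda>z. 0)" "Q \<noteq> (\<lambda>z. 0)"
  shows "(\<lambda>z. P z * Q z) \<noteq> (\<lambda>z. 0)"
proof
  assume zero: "(\<lambda>z. P z * Q z) = (\<lambda>z. 0)"
  obtain u w where u: "P u \<noteq> 0" and w: "Q w \<noteq> 0"
    using assms(3,4) by (auto simp: fun_eq_iff)
  obtain p where p: "\<And>t. poly p t = P (\<chi> i. u $ i + t * (w - u) $ i)"
    using int_poly_on_line[OF assms(1)] by blast
  obtain q where q: "\<And>t. poly q t = Q (\<chi> i. u $ i + t * (w - u) $ i)"
    using int_poly_on_line[OF assms(2)] by blast
  have "poly p 0 \<noteq> 0" "poly q 1 \<noteq> 0"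
    using u w by (simp_all add: p q)
  then have "p * q \<noteq> 0"
    by auto
  moreover have "poly (p * q) t = 0" for t
    using fun_cong[OF zero] by (simp add: p q)
  ultimately show False
    using poly_all_0_iff_0 by blast
qed

section \<open>The supremum norm\<close>

lemma sup_norm_nonneg:
  assumes "compact E" "continuous_on E f"
  shows "0 \<le> sup_norm E f"
proof (cases "E = {}")
  case False
  then obtain x where "x \<in> E"
    by auto
  have "bdd_above ((\<lambda>z. norm (f z)) ` E)"
    by (intro bounded_imp_bdd_above compact_imp_bounded compact_continuous_image
        continuous_on_norm assms)
  from cSUP_upper2[OF this \<open>x \<in> E\<close> norm_ge_zero] False show ?thesis
    by (simp add: sup_norm_def)
qed (simp add: sup_norm_def)

lemma norm_le_sup_norm:
  assumes "compact E" "continuous_on E f" "x \<in> E"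
  shows "norm (f x) \<le> sup_norm E f"
proof -
  have "bdd_above ((\<lambda>z. norm (f z)) ` E)"
    by (intro bounded_imp_bdd_above compact_imp_bounded compact_continuous_image
        continuous_on_norm assms)
  from cSUP_upper[OF assms(3) this] assms(3) show ?thesis
    by (auto simp: sup_norm_def)
qed

lemma sup_norm_least:
  assumes "0 \<le> c" "\<And>x. x \<in> E \<Longrightarrow> norm (f x) \<le> c"
  shows "sup_norm E f \<le> c"
  using assms by (auto simp: sup_norm_def intro: cSUP_least)

lemma sup_norm_mono:
  assumes "compact F" "continuous_on F f" "E \<subseteq> F"
  shows "sup_norm E f \<le> sup_norm F f"
  using assms by (intro sup_norm_least sup_norm_nonneg norm_le_sup_norm) auto

lemma sup_norm_mult_le:
  assumes "compact E" "continuous_on E f" "continuous_on E g"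
  shows "sup_norm E (\<lambda>z. f z * g z) \<le> sup_norm E f * sup_norm E g"
proof (rule sup_norm_least)
  show "0 \<le> sup_norm E f * sup_norm E g"
    using assms by (simp add: sup_norm_nonneg)
  show "norm (f x * g x) \<le> sup_norm E f * sup_norm E g" if "x \<in> E" for x
    unfolding norm_mult using assms that
    by (intro mult_mono norm_le_sup_norm sup_norm_nonneg) auto
qed

section \<open>Integer Chebyshev constants\<close>

lemma nonzero_int_polys_nonempty: "{P \<in> int_polys n. P \<noteq> (\<lambda>z. 0)} \<noteq> {}"
  using one_in_int_polys[of n] by (auto simp: fun_eq_iff)

lemma t_int_n_le:
  assumes "compact E" "P \<in> int_polys n" "P \<noteq> (\<lambda>z. 0)"
  shows "t_int_n n E \<le> sup_norm E P"
  unfolding t_int_n_def using assms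
  by (intro cINF_lower bdd_belowI2[where m = 0] sup_norm_nonneg)
    (auto intro: continuous_on_int_poly)

lemma t_int_n_greatest:
  assumes "\<And>P. P \<in> int_polys n \<Longrightarrow> P \<noteq> (\<lambda>z. 0) \<Longrightarrow> c \<le> sup_norm E P"
  shows "c \<le> t_int_n n E"
  unfolding t_int_n_def using assms by (intro cINF_greatest nonzero_int_polys_nonempty) auto

lemma t_int_n_nonneg: "compact E \<Longrightarrow> 0 \<le> t_int_n n E"
  by (auto intro!: t_int_n_greatest sup_norm_nonneg continuous_on_int_poly)

lemma t_int_n_mono:
  assumes "compact E" "compact F" "E \<subseteq> F"
  shows "t_int_n n E \<le> t_int_n n F"
  using assms
  by (intro t_int_n_greatest) (metis continuous_on_int_poly order_trans sup_norm_mono t_int_n_le)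

text \<open>
  This passes from a bound for each polynomial to one for the infimum. The factor \<open>b\<close> will be the
  norm of the other polynomial of a product, which may be 0: a nonzero polynomial may vanish on \<open>E\<close>.
\<close>

lemma le_mult_t_int_n:
  assumes "compact E" "0 \<le> b"
    and "\<And>P. P \<in> int_polys n \<Longrightarrow> P \<noteq> (\<lambda>z. 0) \<Longrightarrow> c \<le> b * sup_norm E P"
  shows "c \<le> b * t_int_n n E"
proof (cases "b = 0")
  case True
  have "(\<lambda>z. 1 :: complex) \<noteq> (\<lambda>z. 0)"
    by (simp add: fun_eq_iff)
  then show ?thesis
    using assms(3)[OF one_in_int_polys] True by simp
next
  case False
  then have "0 < b"
    using assms(2) by simp
  then have "c / b \<le> t_int_n n E"
    using assms(3) by (intro t_int_n_greatest) (simp add: divide_le_eq mult.commute)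
  then show ?thesis
    using \<open>0 < b\<close> by (simp add: divide_le_eq mult.commute)
qed

lemma t_int_n_submultiplicative:
  fixes E :: "(complex ^ 'd::finite) set"
  assumes "compact E"
  shows "t_int_n (m + n) E \<le> t_int_n m E * t_int_n n E"
proof (rule le_mult_t_int_n[OF assms t_int_n_nonneg[OF assms]])
  fix Q :: "complex ^ 'd \<Rightarrow> complex"
  assume Q: "Q \<in> int_polys n" "Q \<noteq> (\<lambda>z. 0)"
  have contQ: "continuous_on E Q"
    by (rule continuous_on_int_poly[OF Q(1)])
  have "t_int_n (m + n) E \<le> sup_norm E Q * t_int_n m E"
  proof (rule le_mult_t_int_n[OF assms sup_norm_nonneg[OF assms contQ]])
    fix P :: "complex ^ 'd \<Rightarrow> complex"
    assume P: "P \<in> int_polys m" "P \<noteq> (\<lambda>z. 0)"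
    have "t_int_n (m + n) E \<le> sup_norm E (\<lambda>z. P z * Q z)"
      using P Q by (intro t_int_n_le assms int_polys_mult int_polys_mult_nonzero)
    also have "\<dots> \<le> sup_norm E P * sup_norm E Q"
      by (intro sup_norm_mult_le assms contQ continuous_on_int_poly[OF P(1)])
    finally show "t_int_n (m + n) E \<le> sup_norm E Q * sup_norm E P"
      by (simp add: mult.commute)
  qed
  then show "t_int_n (m + n) E \<le> t_int_n m E * sup_norm E Q"
    by (simp add: mult.commute)
qed

lemma t_int_limit:
  assumes "compact E"
  shows "(\<lambda>n. root n (t_int_n n E)) \<longlonglongrightarrow> t_int E"
    and "t_int E = (INF n\<in>{1..}. root n (t_int_n n E))"
proof -
  have *: "(\<lambda>n. root n (t_int_n n E)) \<longlonglongrightarrow> (INF n\<in>{1..}. root n (t_int_n n E))"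
    using assms by (intro fekete_root t_int_n_nonneg t_int_n_submultiplicative)
  then show "t_int E = (INF n\<in>{1..}. root n (t_int_n n E))"
    unfolding t_int_def by (rule limI)
  with * show "(\<lambda>n. root n (t_int_n n E)) \<longlonglongrightarrow> t_int E"
    by simp
qed

lemma bdd_below_root_t_int_n: "compact E \<Longrightarrow> bdd_below ((\<lambda>n. root n (t_int_n n E)) ` {1..})"
  by (rule bdd_belowI2[where m = 0]) (simp add: t_int_n_nonneg)

lemma t_int_le_root: "compact E \<Longrightarrow> 1 \<le> n \<Longrightarrow> t_int E \<le> root n (t_int_n n E)"
  unfolding t_int_limit(2) by (intro cINF_lower bdd_below_root_t_int_n) auto

lemma t_int_nonneg: "compact E \<Longrightarrow> 0 \<le> t_int E"
  unfolding t_int_limit(2) by (rule cINF_greatest) (auto simp: t_int_n_nonneg)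

lemma t_int_mono:
  assumes "compact E" "compact F" "E \<subseteq> F"
  shows "t_int E \<le> t_int F"
proof (rule LIMSEQ_le[OF t_int_limit(1)[OF assms(1)] t_int_limit(1)[OF assms(2)]])
  have "root n (t_int_n n E) \<le> root n (t_int_n n F)" if "n \<ge> 1" for n
    using that by (intro real_root_le_mono t_int_n_mono assms) simp
  then show "\<exists>N. \<forall>n\<ge>N. root n (t_int_n n E) \<le> root n (t_int_n n F)"
    by blast
qed

text \<open>The infimum over \<open>n\<close> and the infimum over polynomials are approximated by one polynomial.\<close>

lemma t_int_less_witness:
  assumes "compact E" "t_int E < c"
  obtains n P where "1 \<le> n" "P \<in> int_polys n" "P \<noteq> (\<lambda>z. 0)" "sup_norm E P < c ^ n"
proof -
  obtain n where n: "1 \<le> n" "root n (t_int_n n E) < c"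
    using assms cINF_less_iff[OF _ bdd_below_root_t_int_n[OF assms(1)], of c]
    by (auto simp: t_int_limit(2))
  have "t_int_n n E = root n (t_int_n n E) ^ n"
    using n(1) t_int_n_nonneg[OF assms(1)] by simp
  also have "\<dots> < c ^ n"
    using n by (intro power_strict_mono) (simp_all add: t_int_n_nonneg[OF assms(1)])
  finally have "\<not> c ^ n \<le> t_int_n n E"
    by simp
  then obtain P where "P \<in> int_polys n" "P \<noteq> (\<lambda>z. 0)" "\<not> c ^ n \<le> sup_norm E P"
    using t_int_n_greatest by blast
  with n(1) show thesis
    by (intro that) auto
qed

section \<open>Fattenings\<close>

lemma subset_fattening: "0 \<le> \<delta> \<Longrightarrow> E \<subseteq> fattening \<delta> E"
  by (force simp: fattening_def)

lemma compact_fattening: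
  assumes "compact E"
  shows "compact (fattening \<delta> E)"
proof -
  have "fattening \<delta> E = {x + y | x y. x \<in> E \<and> y \<in> cball 0 \<delta>}"
  proof (intro set_eqI iffI)
    fix z
    assume "z \<in> fattening \<delta> E"
    then obtain w where "w \<in> E" "z - w \<in> cball 0 \<delta>"
      by (auto simp: fattening_def)
    moreover have "z = w + (z - w)"
      by simp
    ultimately show "z \<in> {x + y | x y. x \<in> E \<and> y \<in> cball 0 \<delta>}"
      by blast
  next
    fix z
    assume "z \<in> {x + y | x y. x \<in> E \<and> y \<in> cball 0 \<delta>}"
    then obtain x y where "z = x + y" "x \<in> E" "norm y \<le> \<delta>"
      by auto
    then show "z \<in> fattening \<delta> E"
      by (auto simp: fattening_def intro!: bexI[of _ x])
  qed
  then show ?thesis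
    using compact_sums[OF assms compact_cball[of 0 \<delta>]] by (simp only:)
qed

lemma fattening_subset_open:
  assumes "compact E" "open U" "E \<subseteq> U"
  obtains \<delta> where "0 < \<delta>" "fattening \<delta> E \<subseteq> U"
proof -
  obtain \<delta> where "0 < \<delta>" "(\<Union>x\<in>E. cball x \<delta>) \<subseteq> U"
    using compact_subset_open_imp_cball_epsilon_subset[OF assms] .
  moreover have "fattening \<delta> E = (\<Union>x\<in>E. cball x \<delta>)"
    by (auto simp: fattening_def dist_norm norm_minus_commute)
  ultimately show thesis
    using that by simp
qed

text \<open>
  The polynomial that is smaller than \<open>c\<^sup>n\<close> on \<open>E\<close> is so on an open neighbourhood of \<open>E\<close>, which by
  compactness contains a fattening.
\<close>

lemma t_int_fattening_le:
  assumes "compact E" "t_int E < c"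
  obtains \<delta> where "0 < \<delta>" "t_int (fattening \<delta> E) \<le> c"
proof -
  obtain n P where n: "1 \<le> n" and P: "P \<in> int_polys n" "P \<noteq> (\<lambda>z. 0)" and small: "sup_norm E P < c ^ n"
    using t_int_less_witness[OF assms] .
  have c: "0 \<le> c"
    using t_int_nonneg[OF assms(1)] assms(2) by linarith
  have cont: "continuous_on S P" for S
    by (rule continuous_on_int_poly[OF P(1)])
  have "open {z. norm (P z) < c ^ n}"
    by (intro open_Collect_less continuous_intros cont)
  moreover have "E \<subseteq> {z. norm (P z) < c ^ n}"
    using norm_le_sup_norm[OF assms(1) cont] small by fastforce
  ultimately obtain \<delta> where \<delta>: "0 < \<delta>" "fattening \<delta> E \<subseteq> {z. norm (P z) < c ^ n}"
    using fattening_subset_open[OF assms(1)] by blast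
  let ?F = "fattening \<delta> E"
  have F: "compact ?F"
    by (rule compact_fattening[OF assms(1)])
  have "t_int_n n ?F \<le> sup_norm ?F P"
    by (rule t_int_n_le[OF F P])
  also have "\<dots> \<le> c ^ n"
    using \<delta>(2) c by (intro sup_norm_least) force+
  finally have "root n (t_int_n n ?F) \<le> root n (c ^ n)"
    using n by (intro real_root_le_mono) simp_all
  also have "\<dots> = c"
    using n c by (simp add: real_root_power_cancel)
  finally have "t_int ?F \<le> c"
    using t_int_le_root[OF F n] by linarith
  with \<delta>(1) show thesis
    by (rule that)
qed

theorem proposition1p2:
  fixes E F :: "(complex ^ 'd::finite) set"
  assumes "compact E" and "compact F"
  shows "(E \<subseteq> F \<longrightarrow> (\<forall>n. t_int_n n E \<le> t_int_n n F) \<and> t_int E \<le> t_int F)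
    \<and> (\<forall>\<epsilon>>0. \<exists>\<delta>>0. 0 \<le> t_int (fattening \<delta> E) - t_int E
                 \<and> t_int (fattening \<delta> E) - t_int E \<le> \<epsilon>)"
proof (intro conjI impI allI)
  show "t_int_n n E \<le> t_int_n n F" if "E \<subseteq> F" for n
    using assms that by (rule t_int_n_mono)
  show "t_int E \<le> t_int F" if "E \<subseteq> F"
    using assms that by (rule t_int_mono)
  fix \<epsilon> :: real
  assume "0 < \<epsilon>"
  then have "t_int E < t_int E + \<epsilon>"
    by simp
  then obtain \<delta> where \<delta>: "0 < \<delta>" "t_int (fattening \<delta> E) \<le> t_int E + \<epsilon>"
    using t_int_fattening_le[OF assms(1)] by blast
  have "t_int E \<le> t_int (fattening \<delta> E)"
    using \<delta>(1) by (intro t_int_mono assms(1) compact_fattening subset_fattening) simp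
  with \<delta> show "\<exists>\<delta>>0. 0 \<le> t_int (fattening \<delta> E) - t_int E \<and> t_int (fattening \<delta> E) - t_int E \<le> \<epsilon>"
    by (intro exI[of _ \<delta>]) simp
qed

end
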